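(* No family of automata networks of polynomial ball growth can be strongly universal.
   Context: An automata network over a finite alphabet $Q$ on finite node set $V$ is a map $F:Q^V\to Q^V$; a directed graph on $V$ is a communication graph of $F$ if each $F(x)_v$ depends only on $x$ restricted to the in-neighbours of $v$. A family of finite graphs $(G_i)_{i\in I}$ has polynomial ball growth if there is $k\in\mathbb N$ such that for every $m$ there is a constant $C_m$ such that for every $i\in I$, every set $X$ of $m$ vertices of $G_i$ and every $n$, $|B(X,n)|\le C_mn^k$, where $B(X,n)$ is the set of vertices at distance at most $n$ from $X$ in $G_i$. A family of automata networks has polynomial ball growth if the family of its underlying communication graphs has. Representations and simulation. For each finite alphabet fix an injective $m_Q:Q\to\{0,1\}^{k_Q}$ extended cellwise; a circuit encoding of $F:Q^n\to Q^n$ is a Boolean circuit $C$ with $m_Q\circ F=C\circ m_Q$. A standard representation of a family is a language with a logarithmic-space algorithm producing a circuit encoding of a member from each word, all members being represented. A block embedding of $Q_F^{V_F}$ into $Q_G^{V_G}$ is a partition $(D_i)_{i\in V_F}$ of $V_G$ with patterns $p_{i,q}\in Q_G^{D_i}$ injective in $q$, giving $\phi(x)|_{D_i}=p_{i,x_i}$; $G$ simulates $F$ via $\phi$ with time constant $T$ if $\phi\circ F=G^T\circ\phi$. A family $(\mathcal F,\mathcal F^* )$ simulates $(\mathcal H,\mathcal H^* )$ in time $T$ and space $S$ if a logarithmic-space Turing machine maps each word representing $H:Q_H^n\to Q_H^n$ to a word representing $F\in\mathcal F$ on $S(n)$ nodes, the number $T(n)$ and a block embedding via which $F$ simulates $H$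 with time constant $T(n)$. $\mathcal B_{Q,\Delta}$ is the family of networks over $Q$ with a communication graph of maximum degree $\le\Delta$, represented by such a graph plus local transition tables. A family is strongly universal if for all finite $Q$ and all $\Delta\ge1$ it simulates $\mathcal B_{Q,\Delta}$ in constant time $T$ and linear space $S$. *)

theory Defs
  imports Complex_Main "HOL-Library.FuncSet" "HOL-Library.Landau_Symbols"
begin

section \<open>Automata networks and communication graphs\<close>

text \<open>
  Alphabets are finite nonempty sets of naturals, and the node set of a network with
  \<open>n \<ge> 1\<close> nodes is \<open>{..<n}\<close>. Configurations and global maps are extensional, so that equality
  of networks is equality of maps \<open>Q\<^sup>V \<rightarrow> Q\<^sup>V\<close>.
\<close>

record network =
  alphabet :: "nat set"
  nodes :: nat
  update :: "(nat \<Rightarrow> nat) \<Rightarrow> (nat \<Rightarrow> nat)"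

definition confs :: "network \<Rightarrow> (nat \<Rightarrow> nat) set" where
  "confs F = {..<nodes F} \<rightarrow>\<^sub>E alphabet F"

definition automata_network :: "network \<Rightarrow> bool" where
  "automata_network F \<longleftrightarrow>
     finite (alphabet F) \<and> alphabet F \<noteq> {} \<and> nodes F \<ge> 1 \<and>
     update F \<in> confs F \<rightarrow>\<^sub>E confs F"

text \<open>An edge \<open>(u, v)\<close> makes \<open>u\<close> an in-neighbour of \<open>v\<close>.\<close>

definition communication_graph :: "network \<Rightarrow> (nat \<times> nat) set \<Rightarrow> bool" where
  "communication_graph F E \<longleftrightarrow>
     E \<subseteq> {..<nodes F} \<times> {..<nodes F} \<and>
     (\<forall>v<nodes F. \<forall>x\<in>confs F. \<forall>y\<in>confs F.
        (\<forall>u. (u, v) \<in> E \<longrightarrow> x u = y u) \<longrightarrow> update F x v = update F y v)"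

definition max_degree_le :: "nat \<Rightarrow> (nat \<times> nat) set \<Rightarrow> nat \<Rightarrow> bool" where
  "max_degree_le n E \<Delta> \<longleftrightarrow>
     (\<forall>v<n. card {u. (u, v) \<in> E} + card {u. (v, u) \<in> E} \<le> \<Delta>)"

section \<open>Polynomial ball growth\<close>

definition graph_ball :: "('v \<times> 'v) set \<Rightarrow> 'v set \<Rightarrow> nat \<Rightarrow> 'v set" where
  "graph_ball E X n = {v. \<exists>u\<in>X. \<exists>d\<le>n. (u, v) \<in> E ^^ d}"

text \<open>
  The radius starts at 1: at radius 0 the bound \<open>C * 0 ^ k\<close> vanishes for \<open>k > 0\<close> although the
  ball is \<open>X\<close> itself.
\<close>

definition polynomial_ball_growth ::
    "'i set \<Rightarrow> ('i \<Rightarrow> 'v set) \<Rightarrow> ('i \<Rightarrow> ('v \<times> 'v) set) \<Rightarrow> bool" where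
  "polynomial_ball_growth I V E \<longleftrightarrow>
     (\<exists>k::nat. \<forall>m::nat. \<exists>C::real. \<forall>i\<in>I. \<forall>X\<subseteq>V i. finite X \<longrightarrow> card X = m \<longrightarrow>
        (\<forall>n\<ge>1. real (card (graph_ball (E i) X n)) \<le> C * real n ^ k))"

definition network_polynomial_ball_growth :: "network set \<Rightarrow> bool" where
  "network_polynomial_ball_growth \<F> \<longleftrightarrow>
     (\<exists>E. (\<forall>F\<in>\<F>. communication_graph F (E F)) \<and>
          polynomial_ball_growth \<F> (\<lambda>F. {..<nodes F}) E)"

section \<open>Logarithmic-space Turing machines\<close>

text \<open>
  Deterministic machines with a two-way read-only input tape delimited by end markers, one
  work tape (one-way infinite, blank symbol 0) and a one-way write-only output tape. The
  initial state is 0, and the machine halts where \<open>trans\<close> is undefined. Only the work tape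
  counts as space.
\<close>

datatype input_symbol = Left_End | Bit_Symbol bool | Right_End

datatype head_move = Move_Left | Stay | Move_Right

record turing_machine =
  states :: nat
  symbols :: nat
  trans :: "nat \<Rightarrow> input_symbol \<Rightarrow> nat \<Rightarrow>
              (nat \<times> head_move \<times> nat \<times> head_move \<times> bool option) option"

definition turing_machine_wf :: "turing_machine \<Rightarrow> bool" where
  "turing_machine_wf M \<longleftrightarrow>
     0 < states M \<and> 0 < symbols M \<and>
     (\<forall>q<states M. \<forall>s. \<forall>a<symbols M. \<forall>q' im a' wm out.
        trans M q s a = Some (q', im, a', wm, out) \<longrightarrow> q' < states M \<and> a' < symbols M)"

record tm_config =
  cur_state :: nat
  input_head :: nat
  work_tape :: "nat \<Rightarrow> nat"
  work_head :: nat
  written :: "bool list"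

definition tm_init :: tm_config where
  "tm_init = \<lparr>cur_state = 0, input_head = 0, work_tape = (\<lambda>_. 0), work_head = 0, written = []\<rparr>"

definition read_input :: "bool list \<Rightarrow> nat \<Rightarrow> input_symbol" where
  "read_input w i =
     (if i = 0 then Left_End
      else if i \<le> length w then Bit_Symbol (w ! (i - 1))
      else Right_End)"

fun move_head :: "head_move \<Rightarrow> nat \<Rightarrow> nat" where
  "move_head Move_Left p = p - 1"
| "move_head Stay p = p"
| "move_head Move_Right p = p + 1"

definition tm_action :: "turing_machine \<Rightarrow> bool list \<Rightarrow> tm_config \<Rightarrow>
    (nat \<times> head_move \<times> nat \<times> head_move \<times> bool option) option" where
  "tm_action M w c =
     trans M (cur_state c) (read_input w (input_head c)) (work_tape c (work_head c))"

definition tm_step :: "turing_machine \<Rightarrow> bool list \<Rightarrow> tm_config \<Rightarrow> tm_config" where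
  "tm_step M w c =
     (case tm_action M w c of
        None \<Rightarrow> c
      | Some (q, im, a, wm, b) \<Rightarrow>
          \<lparr>cur_state = q,
           input_head = min (move_head im (input_head c)) (length w + 1),
           work_tape = (work_tape c)(work_head c := a),
           work_head = move_head wm (work_head c),
           written = written c @ (case b of None \<Rightarrow> [] | Some b' \<Rightarrow> [b'])\<rparr>)"

definition tm_run :: "turing_machine \<Rightarrow> bool list \<Rightarrow> nat \<Rightarrow> tm_config" where
  "tm_run M w t = (tm_step M w ^^ t) tm_init"

definition logspace_computable_on :: "bool list set \<Rightarrow> (bool list \<Rightarrow> bool list) \<Rightarrow> bool" where
  "logspace_computable_on A f \<longleftrightarrow>
     (\<exists>M (c::real). turing_machine_wf M \<and>
        (\<forall>w\<in>A. \<exists>t. tm_action M w (tm_run M w t) = None \<and> written (tm_run M w t) = f w \<and>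
           (\<forall>s\<le>t. real (work_head (tm_run M w s)) \<le> c * log 2 (real (length w) + 2))))"

section \<open>Encoding of structured data as binary words\<close>

text \<open>
  Two bits per token: a bit \<open>b\<close> is written \<open>0b\<close>, and the brackets of a list are \<open>10\<close>
  and \<open>11\<close>. The encoding is injective.
\<close>

datatype bit_tree = Bit bool | List "bit_tree list"

fun to_word :: "bit_tree \<Rightarrow> bool list" where
  "to_word (Bit b) = [False, b]"
| "to_word (List ts) = [True, False] @ concat (map to_word ts) @ [True, True]"

definition word :: "bool list \<Rightarrow> bit_tree" where
  "word w = List (map Bit w)"

text \<open>Binary digits, least significant first.\<close>

fun binary :: "nat \<Rightarrow> bool list" where
  "binary n = (if n = 0 then [] else odd n # binary (n div 2))"

declare binary.simps [simp del]

definition num :: "nat \<Rightarrow> bit_tree" where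
  "num n = word (binary n)"

text \<open>A family of encodings \<open>m\<^sub>Q : Q \<rightarrow> {0,1}\<^sup>k\<close>, with \<open>k\<close> depending on \<open>Q\<close>.\<close>

definition letter_encoding :: "(nat set \<Rightarrow> nat \<Rightarrow> bool list) \<Rightarrow> bool" where
  "letter_encoding m \<longleftrightarrow>
     (\<forall>Q. finite Q \<longrightarrow> inj_on (m Q) Q \<and> (\<exists>k. \<forall>q\<in>Q. length (m Q q) = k))"

section \<open>Circuit encodings and standard representations\<close>

text \<open>A gate refers to inputs, or to earlier gates by their position in the gate list.\<close>

datatype gate =
    Input_Gate nat
  | Const_Gate bool
  | Not_Gate nat
  | And_Gate nat nat
  | Or_Gate nat nat

record circuit =
  inputs :: nat
  gates :: "gate list"
  outputs :: "nat list"

fun gate_wf :: "nat \<Rightarrow> nat \<Rightarrow> gate \<Rightarrow> bool" where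
  "gate_wf n j (Input_Gate i) \<longleftrightarrow> i < n"
| "gate_wf n j (Const_Gate b) \<longleftrightarrow> True"
| "gate_wf n j (Not_Gate a) \<longleftrightarrow> a < j"
| "gate_wf n j (And_Gate a b) \<longleftrightarrow> a < j \<and> b < j"
| "gate_wf n j (Or_Gate a b) \<longleftrightarrow> a < j \<and> b < j"

definition circuit_wf :: "circuit \<Rightarrow> bool" where
  "circuit_wf C \<longleftrightarrow>
     (\<forall>j<length (gates C). gate_wf (inputs C) j (gates C ! j)) \<and>
     (\<forall>j\<in>set (outputs C). j < length (gates C))"

fun gate_value :: "bool list \<Rightarrow> bool list \<Rightarrow> gate \<Rightarrow> bool" where
  "gate_value xs vs (Input_Gate i) = xs ! i"
| "gate_value xs vs (Const_Gate b) = b"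
| "gate_value xs vs (Not_Gate a) = (\<not> vs ! a)"
| "gate_value xs vs (And_Gate a b) = (vs ! a \<and> vs ! b)"
| "gate_value xs vs (Or_Gate a b) = (vs ! a \<or> vs ! b)"

definition circuit_eval :: "circuit \<Rightarrow> bool list \<Rightarrow> bool list" where
  "circuit_eval C xs =
     (let vs = foldl (\<lambda>vs g. vs @ [gate_value xs vs g]) [] (gates C)
      in map (\<lambda>j. vs ! j) (outputs C))"

fun gate_tree :: "gate \<Rightarrow> bit_tree" where
  "gate_tree (Input_Gate i) = List [num 0, num i]"
| "gate_tree (Const_Gate b) = List [num 1, Bit b]"
| "gate_tree (Not_Gate a) = List [num 2, num a]"
| "gate_tree (And_Gate a b) = List [num 3, num a, num b]"
| "gate_tree (Or_Gate a b) = List [num 4, num a, num b]"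

definition circuit_word :: "circuit \<Rightarrow> bool list" where
  "circuit_word C =
     to_word (List [num (inputs C), List (map gate_tree (gates C)), List (map num (outputs C))])"

definition conf_bits ::
    "(nat set \<Rightarrow> nat \<Rightarrow> bool list) \<Rightarrow> network \<Rightarrow> (nat \<Rightarrow> nat) \<Rightarrow> bool list" where
  "conf_bits m F x = concat (map (\<lambda>v. m (alphabet F) (x v)) [0..<nodes F])"

definition circuit_encoding ::
    "(nat set \<Rightarrow> nat \<Rightarrow> bool list) \<Rightarrow> network \<Rightarrow> circuit \<Rightarrow> bool" where
  "circuit_encoding m F C \<longleftrightarrow>
     circuit_wf C \<and>
     (\<forall>x\<in>confs F. length (conf_bits m F x) = inputs C \<and>
        circuit_eval C (conf_bits m F x) = conf_bits m F (update F x))"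

text \<open>
  A representation is given by the relation ``the word \<open>w\<close> represents the network \<open>F\<close>'';
  its language is the domain of that relation.
\<close>

type_synonym representation = "bool list \<Rightarrow> network \<Rightarrow> bool"

definition language :: "representation \<Rightarrow> bool list set" where
  "language R = {w. \<exists>F. R w F}"

definition standard_representation ::
    "(nat set \<Rightarrow> nat \<Rightarrow> bool list) \<Rightarrow> network set \<Rightarrow> representation \<Rightarrow> bool" where
  "standard_representation m \<F> R \<longleftrightarrow>
     (\<forall>w F. R w F \<longrightarrow> F \<in> \<F>) \<and>
     (\<forall>w F F'. R w F \<longrightarrow> R w F' \<longrightarrow> F = F') \<and>
     (\<forall>F\<in>\<F>. \<exists>w. R w F) \<and>
     (\<exists>f. logspace_computable_on (language R) f \<and>
        (\<forall>w F. R w F \<longrightarrow> (\<exists>C. circuit_encoding m F C \<and> f w = circuit_word C)))"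

section \<open>Block embeddings and simulation\<close>

definition block_embedding :: "network \<Rightarrow> network \<Rightarrow> (nat \<Rightarrow> nat set) \<Rightarrow>
    (nat \<Rightarrow> nat \<Rightarrow> nat \<Rightarrow> nat) \<Rightarrow> ((nat \<Rightarrow> nat) \<Rightarrow> (nat \<Rightarrow> nat)) \<Rightarrow> bool" where
  "block_embedding F G D p \<phi> \<longleftrightarrow>
     (\<forall>i<nodes F. D i \<noteq> {}) \<and>
     (\<forall>i<nodes F. \<forall>j<nodes F. i \<noteq> j \<longrightarrow> D i \<inter> D j = {}) \<and>
     (\<Union>i<nodes F. D i) = {..<nodes G} \<and>
     (\<forall>i<nodes F. \<forall>q\<in>alphabet F. p i q \<in> D i \<rightarrow>\<^sub>E alphabet G) \<and>
     (\<forall>i<nodes F. inj_on (p i) (alphabet F)) \<and>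
     (\<forall>x\<in>confs F. \<phi> x \<in> confs G \<and> (\<forall>i<nodes F. restrict (\<phi> x) (D i) = p i (x i)))"

definition simulates_via ::
    "network \<Rightarrow> network \<Rightarrow> ((nat \<Rightarrow> nat) \<Rightarrow> (nat \<Rightarrow> nat)) \<Rightarrow> nat \<Rightarrow> bool" where
  "simulates_via G F \<phi> T \<longleftrightarrow>
     (\<forall>x\<in>confs F. \<phi> (update F x) = (update G ^^ T) (\<phi> x))"

text \<open>
  For every node \<open>i\<close>: the list of the nodes of \<open>D i\<close>, and for every letter \<open>q\<close> the pattern
  \<open>p i q\<close> read along that list.
\<close>

definition block_embedding_tree :: "(nat set \<Rightarrow> nat \<Rightarrow> bool list) \<Rightarrow> network \<Rightarrow> network \<Rightarrow>
    (nat \<Rightarrow> nat set) \<Rightarrow> (nat \<Rightarrow> nat \<Rightarrow> nat \<Rightarrow> nat) \<Rightarrow> bit_tree" where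
  "block_embedding_tree m F G D p =
     List (map (\<lambda>i. List
       [List (map num (sorted_list_of_set (D i))),
        List (map (\<lambda>q. List (map (\<lambda>v. word (m (alphabet G) (p i q v)))
                                  (sorted_list_of_set (D i))))
                  (sorted_list_of_set (alphabet F)))])
       [0..<nodes F])"

definition family_simulates :: "(nat set \<Rightarrow> nat \<Rightarrow> bool list) \<Rightarrow> representation \<Rightarrow>
    representation \<Rightarrow> (nat \<Rightarrow> nat) \<Rightarrow> (nat \<Rightarrow> nat) \<Rightarrow> bool" where
  "family_simulates m RF RH T S \<longleftrightarrow>
     (\<exists>f. logspace_computable_on (language RH) f \<and>
        (\<forall>w H. RH w H \<longrightarrow>
           (\<exists>w' F D p \<phi>.
              RF w' F \<and> nodes F = S (nodes H) \<and>
              block_embedding H F D p \<phi> \<and>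
              simulates_via F H \<phi> (T (nodes H)) \<and>
              f w = to_word (List [word w', num (T (nodes H)),
                                   block_embedding_tree m H F D p]))))"

section \<open>Bounded-degree networks and strong universality\<close>

definition bounded_degree_networks :: "nat set \<Rightarrow> nat \<Rightarrow> network set" where
  "bounded_degree_networks Q \<Delta> =
     {H. automata_network H \<and> alphabet H = Q \<and>
         (\<exists>E. communication_graph H E \<and> max_degree_le (nodes H) E \<Delta>)}"

text \<open>
  A network over \<open>Q\<close> with a communication graph \<open>E\<close> of maximum degree at most \<open>\<Delta>\<close> is
  represented by listing, for each node \<open>v\<close>, its in-neighbours in \<open>E\<close> and the table of its
  local transition map \<open>\<tau> v\<close>. The argument of \<open>\<tau> v\<close> is the list of the states of these
  in-neighbours, and the table runs through all such lists in lexicographic order.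
\<close>

definition bounded_degree_representation ::
    "(nat set \<Rightarrow> nat \<Rightarrow> bool list) \<Rightarrow> nat set \<Rightarrow> nat \<Rightarrow> representation" where
  "bounded_degree_representation m Q \<Delta> w H \<longleftrightarrow>
     automata_network H \<and> alphabet H = Q \<and>
     (\<exists>E nb \<tau>.
        communication_graph H E \<and> max_degree_le (nodes H) E \<Delta> \<and>
        (\<forall>v<nodes H. distinct (nb v) \<and> set (nb v) = {u. (u, v) \<in> E}) \<and>
        (\<forall>v<nodes H. \<forall>x\<in>confs H. update H x v = \<tau> v (map x (nb v))) \<and>
        w = to_word (List (map (\<lambda>v. List
              [List (map num (nb v)),
               List (map (\<lambda>a. word (m Q (\<tau> v a)))
                 (product_lists (replicate (length (nb v)) (sorted_list_of_set Q))))])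
              [0..<nodes H])))"

lemma bounded_degree_representation_complete:
  "(\<exists>w. bounded_degree_representation m Q \<Delta> w H) \<longleftrightarrow> H \<in> bounded_degree_networks Q \<Delta>"
proof
  assume "\<exists>w. bounded_degree_representation m Q \<Delta> w H"
  then show "H \<in> bounded_degree_networks Q \<Delta>"
    unfolding bounded_degree_representation_def bounded_degree_networks_def by blast
next
  assume "H \<in> bounded_degree_networks Q \<Delta>"
  then obtain E where H: "automata_network H" "alphabet H = Q"
      and E: "communication_graph H E" "max_degree_le (nodes H) E \<Delta>"
    unfolding bounded_degree_networks_def by blast
  define nb where "nb v = sorted_list_of_set {u. (u, v) \<in> E}" for v
  have fin: "finite {u. (u, v) \<in> E}" for v
    by (rule finite_subset[of _ "{..<nodes H}"])
       (use E(1) in \<open>auto simp: communication_graph_def\<close>)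
  have nb: "distinct (nb v) \<and> set (nb v) = {u. (u, v) \<in> E}" for v
    using fin[of v] by (simp add: nb_def)
  define \<tau> where "\<tau> v a = update H (SOME x. x \<in> confs H \<and> map x (nb v) = a) v" for v a
  have \<tau>: "update H x v = \<tau> v (map x (nb v))" if "v < nodes H" "x \<in> confs H" for v x
  proof -
    define y where "y = (SOME y. y \<in> confs H \<and> map y (nb v) = map x (nb v))"
    have y: "y \<in> confs H \<and> map y (nb v) = map x (nb v)"
      unfolding y_def by (rule someI[of _ x]) (use that in simp)
    then have "\<forall>u. (u, v) \<in> E \<longrightarrow> x u = y u"
      using nb[of v] by auto
    then have "update H x v = update H y v"
      using E(1) that y unfolding communication_graph_def by blast
    then show ?thesis
      by (simp add: \<tau>_def y_def)
  qed
  show "\<exists>w. bounded_degree_representation m Q \<Delta> w H"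
    unfolding bounded_degree_representation_def using H E nb \<tau> by blast
qed

definition strongly_universal ::
    "(nat set \<Rightarrow> nat \<Rightarrow> bool list) \<Rightarrow> representation \<Rightarrow> bool" where
  "strongly_universal m R \<longleftrightarrow>
     (\<forall>Q \<Delta>. finite Q \<longrightarrow> \<Delta> \<ge> 1 \<longrightarrow>
        (\<exists>T S. (\<exists>c. \<forall>n. T n = c) \<and> (\<lambda>n. real (S n)) \<in> O(\<lambda>n. real n) \<and>
           family_simulates m R (bounded_degree_representation m Q \<Delta>) T S))"

end

theory Submission imports Defs begin

text \<open>
  The networks to be simulated are disjunction networks on de Bruijn graphs: on \<open>2 ^ r\<close> nodes the
  graph has degree at most 4, and flipping any single node of the zero configuration changes every
  node after \<open>r\<close> steps. A simulation in constant time \<open>T\<close> transports this to a path of length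
  \<open>r * T\<close> in the communication graph of the simulator, from any block to every other block. By
  linear space some block has bounded size, so the ball of radius \<open>O(r)\<close> around a set of bounded
  size has at least \<open>2 ^ r\<close> elements, which is not polynomial in \<open>r\<close>.
\<close>

section \<open>Propagation of information\<close>

lemma funpow_update_in_confs:
  assumes "automata_network F" and "x \<in> confs F"
  shows "(update F ^^ t) x \<in> confs F"
proof (induction t)
  case (Suc t)
  have "update F \<in> confs F \<rightarrow> confs F"
    using assms(1) by (auto simp: automata_network_def)
  with Suc show ?case by auto
qed (use assms in simp)

text \<open>A difference at \<open>v\<close> after one step comes from a difference at some
  in-neighbour before it. Tracing this back through \<open>t\<close> steps yields a walk of length
  exactly \<open>t\<close>.\<close>

lemma funpow_update_depends:
  assumes F: "automata_network F" and E: "communication_graph F E"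
    and x: "x \<in> confs F" and y: "y \<in> confs F"
    and "v < nodes F" and "(update F ^^ t) x v \<noteq> (update F ^^ t) y v"
  shows "\<exists>u. (u, v) \<in> E ^^ t \<and> x u \<noteq> y u"
  using assms(5,6)
proof (induction t arbitrary: v)
  case 0
  then show ?case by auto
next
  case (Suc t)
  let ?x = "(update F ^^ t) x" and ?y = "(update F ^^ t) y"
  have "?x \<in> confs F" "?y \<in> confs F"
    using funpow_update_in_confs[OF F] x y by auto
  moreover have "update F ?x v \<noteq> update F ?y v"
    using Suc.prems by simp
  ultimately obtain w where w: "(w, v) \<in> E" "?x w \<noteq> ?y w"
    using E Suc.prems(1) unfolding communication_graph_def by blast
  moreover have "w < nodes F"
    using E w(1) by (auto simp: communication_graph_def)
  ultimately show ?case
    using Suc.IH[of w] by auto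
qed

section \<open>Simulations through block embeddings\<close>

lemma simulates_via_funpow:
  assumes "automata_network F" and "simulates_via G F \<phi> T" and "x \<in> confs F"
  shows "\<phi> ((update F ^^ t) x) = (update G ^^ (T * t)) (\<phi> x)"
proof (induction t)
  case 0
  then show ?case by simp
next
  case (Suc t)
  have "\<phi> ((update F ^^ Suc t) x) = (update G ^^ T) (\<phi> ((update F ^^ t) x))"
    using assms(2) funpow_update_in_confs[OF assms(1,3)] by (simp add: simulates_via_def)
  also have "\<dots> = (update G ^^ (T + T * t)) (\<phi> x)"
    by (simp add: Suc funpow_add)
  finally show ?case by (simp add: algebra_simps)
qed

text \<open>Guards against the convention that infinite sets have \<open>card\<close> 0. Distance 0
  contributes only \<open>X\<close>; any other vertex of the ball is the head of an edge, hence in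
  \<open>A\<close>.\<close>

lemma finite_graph_ball:
  assumes "E \<subseteq> A \<times> A" "finite A" "finite X"
  shows "finite (graph_ball E X n)"
proof (rule finite_subset)
  show "graph_ball E X n \<subseteq> X \<union> A"
  proof
    fix v assume "v \<in> graph_ball E X n"
    then obtain u d where "u \<in> X" "(u, v) \<in> E ^^ d"
      by (auto simp: graph_ball_def)
    then show "v \<in> X \<union> A"
      using assms(1) by (cases d) auto
  qed
qed (use assms in simp)

text \<open>Since \<open>x\<close> and \<open>y\<close> differ at most at \<open>i\<close>, their
  images under \<phi> differ only inside \<open>D i\<close>. A difference at \<open>j\<close> after
  \<open>t\<close> steps therefore shows up at a node of \<open>D j\<close> reached from
  \<open>D i\<close> by a walk of length \<open>T * t\<close>, and distinct \<open>j\<close> give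
  distinct nodes because blocks are disjoint.\<close>

lemma card_le_card_graph_ball_if_simulates:
  assumes F: "automata_network F" and G: "automata_network G"
    and E: "communication_graph G E"
    and emb: "block_embedding F G D p \<phi>" and sim: "simulates_via G F \<phi> T"
    and x: "x \<in> confs F" and y: "y \<in> confs F"
    and i: "i < nodes F" and xy: "\<And>j. j < nodes F \<Longrightarrow> j \<noteq> i \<Longrightarrow> x j = y j"
    and J: "J \<subseteq> {j. j < nodes F \<and> (update F ^^ t) x j \<noteq> (update F ^^ t) y j}"
    and n: "T * t \<le> n"
  shows "card J \<le> card (graph_ball E (D i) n)"
proof -
  have cover: "(\<Union>j<nodes F. D j) = {..<nodes G}"
    using emb unfolding block_embedding_def by blast
  have D_subset: "D j \<subseteq> {..<nodes G}" if "j < nodes F" for j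
    using cover that by blast
  have pattern: "restrict (\<phi> z) (D j) = p j (z j)" if "z \<in> confs F" "j < nodes F" for z j
    using emb that unfolding block_embedding_def by blast
  have disjoint: "D j \<inter> D l = {}" if "j < nodes F" "l < nodes F" "j \<noteq> l" for j l
    using emb that unfolding block_embedding_def by blast
  have "\<forall>j\<in>J. \<exists>v. v \<in> D j \<and> v \<in> graph_ball E (D i) n"
  proof
    fix j assume "j \<in> J"
    let ?x = "(update F ^^ t) x" and ?y = "(update F ^^ t) y"
    have j: "j < nodes F" and neq: "?x j \<noteq> ?y j"
      using J \<open>j \<in> J\<close> by auto
    have confs: "?x \<in> confs F" "?y \<in> confs F"
      using funpow_update_in_confs[OF F] x y by auto
    then have "?x j \<in> alphabet F" "?y j \<in> alphabet F"
      using j by (auto simp: confs_def)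
    then have "p j (?x j) \<noteq> p j (?y j)"
      using emb j neq unfolding block_embedding_def inj_on_def by blast
    then have "restrict (\<phi> ?x) (D j) \<noteq> restrict (\<phi> ?y) (D j)"
      using pattern confs j by simp
    then obtain v where v: "v \<in> D j" "\<phi> ?x v \<noteq> \<phi> ?y v"
      using restrict_ext by metis
    have "v < nodes G"
      using D_subset[OF j] v(1) by auto
    moreover have "\<phi> x \<in> confs G" "\<phi> y \<in> confs G"
      using emb x y unfolding block_embedding_def by blast+
    moreover have "(update G ^^ (T * t)) (\<phi> x) v \<noteq> (update G ^^ (T * t)) (\<phi> y) v"
      using v(2) simulates_via_funpow[OF F sim] x y by simp
    ultimately obtain u where u: "(u, v) \<in> E ^^ (T * t)" "\<phi> x u \<noteq> \<phi> y u"
      using funpow_update_depends[OF G E] by blast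
    \<comment> \<open>Configurations are extensional: outside the node set both images take the same
      default value, so they cannot differ there.\<close>
    have "u < nodes G"
      using u(2) PiE_arb[of "\<phi> x" _ _ u] PiE_arb[of "\<phi> y" _ _ u]
        \<open>\<phi> x \<in> confs G\<close> \<open>\<phi> y \<in> confs G\<close>
      unfolding confs_def by (metis lessThan_iff)
    then have "u \<in> (\<Union>l<nodes F. D l)"
      using cover by simp
    then obtain l where l: "l < nodes F" "u \<in> D l"
      by blast
    have "p l (x l) \<noteq> p l (y l)"
      using pattern[OF x l(1)] pattern[OF y l(1)] u(2) l(2) by (metis restrict_apply')
    then have "l = i"
      using xy l(1) by metis
    then have "v \<in> graph_ball E (D i) n"
      using u(1) l(2) n by (auto simp: graph_ball_def)
    with v(1) show "\<exists>v. v \<in> D j \<and> v \<in> graph_ball E (D i) n" by blast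
  qed
  then obtain f where f: "f j \<in> D j" "f j \<in> graph_ball E (D i) n" if "j \<in> J" for j
    by metis
  have "inj_on f J"
  proof (rule inj_onI)
    fix j l assume *: "j \<in> J" "l \<in> J" "f j = f l"
    then have "f j \<in> D j" "f j \<in> D l"
      using f(1)[of j] f(1)[of l] by simp_all
    moreover have "j < nodes F" "l < nodes F"
      using * J by auto
    ultimately show "j = l"
      using disjoint by blast
  qed
  moreover have "f ` J \<subseteq> graph_ball E (D i) n"
    using f by auto
  moreover have "finite (graph_ball E (D i) n)"
  proof (rule finite_graph_ball)
    show "E \<subseteq> {..<nodes G} \<times> {..<nodes G}"
      using E by (simp add: communication_graph_def)
    show "finite (D i)"
      using D_subset[OF i] by (rule finite_subset) simp
  qed simp
  ultimately show ?thesis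
    by (rule card_inj_on_le)
qed

text \<open>Averaging: if every block had at least \<open>c + 1\<close> nodes, the partition would
  need more than \<open>c * nodes F\<close> of them.\<close>

lemma exists_block_card_le:
  fixes c :: nat
  assumes emb: "block_embedding F G D p \<phi>" and "nodes F \<ge> 1" and c: "nodes G \<le> c * nodes F"
  shows "\<exists>i<nodes F. card (D i) \<le> c"
proof (rule ccontr)
  assume "\<not> ?thesis"
  then have big: "Suc c \<le> card (D i)" if "i < nodes F" for i
    using that by (meson not_less_eq_eq)
  have "(\<Union>i<nodes F. D i) = {..<nodes G}"
    using emb unfolding block_embedding_def by blast
  \<comment> \<open>An infinite block would have \<open>card\<close> 0, against the lower bound
    \<open>Suc c\<close>.\<close>
  moreover have "finite (D i)" if "i < nodes F" for i
    using big[OF that] by (metis card.infinite not_less_eq_eq zero_le)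
  moreover have "\<forall>i<nodes F. \<forall>j<nodes F. i \<noteq> j \<longrightarrow> D i \<inter> D j = {}"
    using emb unfolding block_embedding_def by blast
  ultimately have "nodes G = (\<Sum>i<nodes F. card (D i))"
    using card_UN_disjoint[of "{..<nodes F}" D] by simp
  also have "\<dots> \<ge> (\<Sum>i<nodes F. Suc c)"
    using big by (intro sum_mono) auto
  finally show False
    using c \<open>nodes F \<ge> 1\<close> by (simp add: mult.commute)
qed

section \<open>Disjunction networks\<close>

text \<open>With disjunction, ones arriving along different walks never cancel, so a perturbation of
  the zero configuration reaches the end of every walk.\<close>

definition disjunction_network :: "nat \<Rightarrow> (nat \<times> nat) set \<Rightarrow> network" where
  "disjunction_network n E =
     \<lparr>alphabet = {0, 1}, nodes = n,
      update = (\<lambda>x\<in>{..<n} \<rightarrow>\<^sub>E {0, 1}. \<lambda>v\<in>{..<n}. if \<exists>u. (u, v) \<in> E \<and> x u = 1 then 1 else 0)\<rparr>"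

definition unit_conf :: "nat \<Rightarrow> nat set \<Rightarrow> nat \<Rightarrow> nat" where
  "unit_conf n A = (\<lambda>v\<in>{..<n}. if v \<in> A then 1 else 0)"

lemma disjunction_network_simps [simp]:
  "alphabet (disjunction_network n E) = {0, 1}" "nodes (disjunction_network n E) = n"
  by (simp_all add: disjunction_network_def)

lemma automata_network_disjunction_network:
  assumes "n \<ge> 1"
  shows "automata_network (disjunction_network n E)"
proof -
  have "update (disjunction_network n E) \<in>
      confs (disjunction_network n E) \<rightarrow>\<^sub>E confs (disjunction_network n E)"
    unfolding confs_def disjunction_network_def by (simp add: restrict_PiE_iff)
  then show ?thesis
    using assms by (simp add: automata_network_def)
qed

lemma communication_graph_disjunction_network:
  assumes "E \<subseteq> {..<n} \<times> {..<n}"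
  shows "communication_graph (disjunction_network n E) E"
proof -
  have "update (disjunction_network n E) x v = update (disjunction_network n E) y v"
    if "v < n" "x \<in> confs (disjunction_network n E)" "y \<in> confs (disjunction_network n E)"
      "\<forall>u. (u, v) \<in> E \<longrightarrow> x u = y u" for x y v
  proof -
    have "(\<exists>u. (u, v) \<in> E \<and> x u = 1) \<longleftrightarrow> (\<exists>u. (u, v) \<in> E \<and> y u = 1)"
      using that(4) by auto
    then show ?thesis
      using that(1-3) by (simp add: disjunction_network_def confs_def)
  qed
  then show ?thesis
    unfolding communication_graph_def disjunction_network_simps using assms by blast
qed

lemma unit_conf_in_confs: "unit_conf n A \<in> confs (disjunction_network n E)"
  by (auto simp: unit_conf_def confs_def)

lemma update_unit_conf:
  assumes "E \<subseteq> {..<n} \<times> {..<n}"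
  shows "update (disjunction_network n E) (unit_conf n A) = unit_conf n (E `` A)"
proof
  fix v
  have "(\<exists>u. (u, v) \<in> E \<and> unit_conf n A u = 1) \<longleftrightarrow> v \<in> E `` A"
    using assms by (auto simp: unit_conf_def)
  then show "update (disjunction_network n E) (unit_conf n A) v = unit_conf n (E `` A) v"
    \<comment> \<open>\<open>unit_conf\<close> is unfolded only in the second pass, so that the
      first can use its membership in \<open>confs\<close> to evaluate the restricted update
      map.\<close>
    using unit_conf_in_confs[of n A E]
    by (simp add: disjunction_network_def confs_def) (simp add: unit_conf_def)
qed

lemma funpow_update_unit_conf:
  assumes "E \<subseteq> {..<n} \<times> {..<n}"
  shows "(update (disjunction_network n E) ^^ t) (unit_conf n A) = unit_conf n ((E ^^ t) `` A)"
  by (induction t) (simp_all add: update_unit_conf[OF assms] relcomp_Image)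

section \<open>De Bruijn graphs\<close>

text \<open>For \<open>N = 2 ^ r\<close>, nodes are binary words of length \<open>r\<close>; an edge
  drops the leading bit and appends a bit at the end.\<close>

definition de_bruijn :: "nat \<Rightarrow> (nat \<times> nat) set" where
  "de_bruijn N = {(u, v). u < N \<and> v < N \<and> (v = 2 * u mod N \<or> v = (2 * u + 1) mod N)}"

lemma de_bruijn_subset: "de_bruijn N \<subseteq> {..<N} \<times> {..<N}"
  by (auto simp: de_bruijn_def)

text \<open>The degree counts both directions, two each. Evenness of \<open>N\<close> matters for
  in-neighbours: reduction modulo \<open>N\<close> keeps the parity, so each \<open>v\<close> has
  only the two halves listed below as possible predecessors.\<close>

lemma max_degree_le_de_bruijn:
  assumes "even N"
  shows "max_degree_le N (de_bruijn N) 4"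
proof -
  have "card {u. (u, v) \<in> de_bruijn N} \<le> 2" for v
  proof -
    have "u \<in> {v div 2, (v + N) div 2}" if u: "(u, v) \<in> de_bruijn N" for u
    proof -
      obtain M where M: "N = 2 * M"
        using assms by (auto elim: evenE)
      \<comment> \<open>As \<open>u < N\<close>, doubling wraps around at most once, precisely when
        \<open>u\<close> is at least \<open>M\<close>.\<close>
      have "2 * u mod N = (if u < M then 2 * u else 2 * u - N)"
        "(2 * u + 1) mod N = (if u < M then 2 * u + 1 else 2 * u + 1 - N)"
        using u M by (auto simp: de_bruijn_def mod_if)
      then show ?thesis
        using u M by (auto simp: de_bruijn_def split: if_splits)
    qed
    then have "{u. (u, v) \<in> de_bruijn N} \<subseteq> {v div 2, (v + N) div 2}"
      by blast
    then have "card {u. (u, v) \<in> de_bruijn N} \<le> card {v div 2, (v + N) div 2}"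
      by (intro card_mono) auto
    also have "\<dots> \<le> 2"
      by (simp add: card_insert_if)
    finally show ?thesis .
  qed
  moreover have "card {u. (v, u) \<in> de_bruijn N} \<le> 2" for v
  proof -
    have "card {u. (v, u) \<in> de_bruijn N} \<le> card {2 * v mod N, (2 * v + 1) mod N}"
      by (intro card_mono) (auto simp: de_bruijn_def)
    also have "\<dots> \<le> 2"
      by (simp add: card_insert_if)
    finally show ?thesis .
  qed
  ultimately show ?thesis
    unfolding max_degree_le_def by (metis add_mono numeral_Bit0)
qed

text \<open>\<open>t\<close> steps append the \<open>t\<close> bits of \<open>s\<close>. In the
  induction \<open>s div 2\<close> holds the earlier bits and \<open>s mod 2\<close> is the last
  one.\<close>

lemma de_bruijn_relpow:
  assumes "u < N" "s < 2 ^ t"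
  shows "(u, (2 ^ t * u + s) mod N) \<in> de_bruijn N ^^ t"
  using assms(2)
proof (induction t arbitrary: s)
  case 0
  then show ?case using assms(1) by simp
next
  case (Suc t)
  let ?w = "2 ^ t * u + s div 2"
  have "(u, ?w mod N) \<in> de_bruijn N ^^ t"
    using Suc by auto
  moreover have "(?w mod N, (2 ^ Suc t * u + s) mod N) \<in> de_bruijn N"
  proof -
    have "2 ^ Suc t * u + s = 2 * ?w + s mod 2"
      by (simp add: algebra_simps)
    then have "(2 ^ Suc t * u + s) mod N = (2 * (?w mod N) + s mod 2) mod N"
      by (metis mod_add_left_eq mod_mult_right_eq)
    moreover have "s mod 2 = 0 \<or> s mod 2 = 1"
      by auto
    ultimately show ?thesis
      using assms(1) by (auto simp: de_bruijn_def)
  qed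
  ultimately show ?case by auto
qed

text \<open>After \<open>r\<close> steps all bits of \<open>u\<close> have been shifted out: take
  \<open>s = v\<close>, as \<open>2 ^ r * u\<close> vanishes modulo \<open>2 ^ r\<close>.\<close>

lemma de_bruijn_relpow_complete:
  assumes "u < 2 ^ r" "v < 2 ^ r"
  shows "(u, v) \<in> de_bruijn (2 ^ r) ^^ r"
  using de_bruijn_relpow[OF assms] assms(2) by simp

section \<open>Growth of balls\<close>

text \<open>Blocks have bounded, not prescribed, size. The maximum of the constants for sizes
  \<open>0..c\<close> serves all of them, and the exponent \<open>k\<close> stays independent of
  \<open>c\<close>.\<close>

lemma polynomial_ball_growth_card_le:
  assumes "polynomial_ball_growth I V E"
  obtains k where "\<And>c. \<exists>C. \<forall>i\<in>I. \<forall>X\<subseteq>V i. finite X \<longrightarrow> card X \<le> c \<longrightarrow>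
    (\<forall>n\<ge>1. real (card (graph_ball (E i) X n)) \<le> C * real n ^ k)"
proof -
  obtain k B where B: "\<And>m i X n. i \<in> I \<Longrightarrow> X \<subseteq> V i \<Longrightarrow> finite X \<Longrightarrow> card X = m \<Longrightarrow> n \<ge> 1 \<Longrightarrow>
      real (card (graph_ball (E i) X n)) \<le> B m * real n ^ k"
    using assms unfolding polynomial_ball_growth_def by metis
  show ?thesis
  proof (rule that)
    fix c
    show "\<exists>C. \<forall>i\<in>I. \<forall>X\<subseteq>V i. finite X \<longrightarrow> card X \<le> c \<longrightarrow>
      (\<forall>n\<ge>1. real (card (graph_ball (E i) X n)) \<le> C * real n ^ k)"
    proof (intro exI ballI allI impI)
      fix i X and n :: nat
      assume *: "i \<in> I" "X \<subseteq> V i" "finite X" "card X \<le> c" "n \<ge> 1"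
      have "real (card (graph_ball (E i) X n)) \<le> B (card X) * real n ^ k"
        using B * by blast
      also have "\<dots> \<le> Max (B ` {..c}) * real n ^ k"
        using * by (intro mult_right_mono Max_ge) auto
      finally show "real (card (graph_ball (E i) X n)) \<le> Max (B ` {..c}) * real n ^ k" .
    qed
  qed
qed

text \<open>The substitution \<open>ln 2 * r\<close> for the variable reduces this to the limit 0 of
  a power divided by \<open>exp\<close>.\<close>

lemma eventually_polynomial_less_exponential:
  "eventually (\<lambda>r. C * real (a * r) ^ k < 2 ^ r) sequentially"
proof -
  have "filterlim (\<lambda>r. ln 2 * real r) at_top sequentially"
    by (intro filterlim_tendsto_pos_mult_at_top[OF tendsto_const] filterlim_real_sequentially) simp
  then have "(\<lambda>r. (ln 2 * real r) ^ k / exp (ln 2 * real r)) \<longlonglongrightarrow> 0"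
    by (rule filterlim_compose[OF tendsto_power_div_exp_0])
  then have "(\<lambda>r. C * (a / ln 2) ^ k * ((ln 2 * real r) ^ k / exp (ln 2 * real r)))
      \<longlonglongrightarrow> C * (a / ln 2) ^ k * 0"
    by (intro tendsto_mult tendsto_const)
  moreover have "C * (a / ln 2) ^ k * ((ln 2 * real r) ^ k / exp (ln 2 * real r)) =
      C * real (a * r) ^ k / 2 ^ r" for r
    by (simp add: exp_of_nat2_mult power_mult_distrib power_divide)
  ultimately have "(\<lambda>r. C * real (a * r) ^ k / 2 ^ r) \<longlonglongrightarrow> 0"
    by simp
  then have "eventually (\<lambda>r. C * real (a * r) ^ k / 2 ^ r < 1) sequentially"
    by (rule order_tendstoD) simp
  then show ?thesis
    by (simp add: divide_simps del: of_nat_mult)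
qed

section \<open>Choice of parameters and final count\<close>

theorem mainTheorem6:
  fixes m :: "nat set \<Rightarrow> nat \<Rightarrow> bool list"
    and \<F> :: "network set"
    and R :: representation
  assumes "letter_encoding m"
    and "\<forall>F\<in>\<F>. automata_network F"
    and "standard_representation m \<F> R"
    and "network_polynomial_ball_growth \<F>"
  shows "\<not> strongly_universal m R"
proof
  assume "strongly_universal m R"
  then have "\<exists>T S. (\<exists>c. \<forall>n. T n = c) \<and> (\<lambda>n. real (S n)) \<in> O(\<lambda>n. real n) \<and>
      family_simulates m R (bounded_degree_representation m {0, 1} 4) T S"
    unfolding strongly_universal_def by simp
  then obtain T S where T_const: "\<exists>c. \<forall>n. T n = c" and S: "(\<lambda>n. real (S n)) \<in> O(\<lambda>n. real n)"
    and sim: "family_simulates m R (bounded_degree_representation m {0, 1} 4) T S"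
    by blast
  obtain T0 where T0: "\<And>n. T n = T0"
    using T_const by blast
  obtain c :: real where c: "eventually (\<lambda>n. real (S n) \<le> c * real n) sequentially"
    using S by (auto elim!: landau_o.bigE)
  \<comment> \<open>The space constant rounded up to a natural number, which will bound the size of
    the smallest block.\<close>
  define b where "b = nat \<lceil>c\<rceil>"
  have "eventually (\<lambda>n. S n \<le> b * n) sequentially"
    using c
  proof eventually_elim
    case (elim n)
    have "c * real n \<le> real b * real n"
      unfolding b_def by (intro mult_right_mono) linarith+
    with elim have "real (S n) \<le> real (b * n)"
      by simp
    then show ?case by linarith
  qed
  moreover have "filterlim (\<lambda>r::nat. 2 ^ r :: nat) at_top sequentially"
    by (rule filterlim_at_top_mono[OF filterlim_ident]) (simp add: less_imp_le)
  ultimately have S_le: "eventually (\<lambda>r. S (2 ^ r) \<le> b * 2 ^ r) sequentially"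
    by (rule eventually_compose_filterlim)
  obtain E where E: "\<forall>F\<in>\<F>. communication_graph F (E F)"
    and growth: "polynomial_ball_growth \<F> (\<lambda>F. {..<nodes F}) E"
    using assms(4) unfolding network_polynomial_ball_growth_def by blast
  obtain k where "\<And>c. \<exists>C. \<forall>F\<in>\<F>. \<forall>X\<subseteq>{..<nodes F}. finite X \<longrightarrow> card X \<le> c \<longrightarrow>
      (\<forall>n\<ge>1. real (card (graph_ball (E F) X n)) \<le> C * real n ^ k)"
    using polynomial_ball_growth_card_le[OF growth] by blast
  then obtain C where C: "\<forall>F\<in>\<F>. \<forall>X\<subseteq>{..<nodes F}. finite X \<longrightarrow> card X \<le> b \<longrightarrow>
      (\<forall>n\<ge>1. real (card (graph_ball (E F) X n)) \<le> C * real n ^ k)"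
    by blast
  \<comment> \<open>\<open>b\<close>, \<open>k\<close> and \<open>C\<close> are fixed before
    \<open>r\<close>. The radius uses \<open>Suc T0\<close> so that it is at least 1 even if
    \<open>T0\<close> is 0; \<open>r \<ge> 1\<close> also makes \<open>2 ^ r\<close> even.\<close>
  have "eventually (\<lambda>r. S (2 ^ r) \<le> b * 2 ^ r \<and> C * real (Suc T0 * r) ^ k < 2 ^ r \<and> r \<ge> 1)
      sequentially"
    by (intro eventually_conj S_le eventually_polynomial_less_exponential eventually_ge_at_top)
  then obtain r where r: "S (2 ^ r) \<le> b * 2 ^ r" "C * real (Suc T0 * r) ^ k < 2 ^ r" "r \<ge> 1"
    by (auto simp: eventually_sequentially)
  define N :: nat where "N = 2 ^ r"
  define H where "H = disjunction_network N (de_bruijn N)"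
  have [simp]: "nodes H = N"
    by (simp add: H_def)
  have "N \<ge> 1" "even N"
    using r(3) by (simp_all add: N_def)
  have H: "automata_network H"
    using automata_network_disjunction_network[OF \<open>N \<ge> 1\<close>] by (simp add: H_def)
  have "communication_graph H (de_bruijn N)"
    unfolding H_def by (rule communication_graph_disjunction_network[OF de_bruijn_subset])
  then have "H \<in> bounded_degree_networks {0, 1} 4"
    using H max_degree_le_de_bruijn[OF \<open>even N\<close>]
    by (auto simp: bounded_degree_networks_def H_def)
  then obtain w where "bounded_degree_representation m {0, 1} 4 w H"
    using bounded_degree_representation_complete by blast
  then obtain w' G D p \<phi> where "R w' G" and nodes_G: "nodes G = S N"
    and emb: "block_embedding H G D p \<phi>" and via: "simulates_via G H \<phi> T0"
    using sim T0 unfolding family_simulates_def by (metis \<open>nodes H = N\<close>)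
  have "G \<in> \<F>"
    using assms(3) \<open>R w' G\<close> unfolding standard_representation_def by blast
  then have G: "automata_network G" and EG: "communication_graph G (E G)"
    using assms(2) E by auto
  have "nodes G \<le> b * nodes H"
    using r(1) nodes_G by (simp add: N_def)
  \<comment> \<open>The small block is known only once the embedding is given, so the perturbation
    must be able to start from any node \<open>i\<close>.\<close>
  then obtain i where i: "i < N" "card (D i) \<le> b"
    using exists_block_card_le[OF emb] \<open>N \<ge> 1\<close> by auto
  have "D i \<subseteq> {..<nodes G}"
    using emb i(1) unfolding block_embedding_def by auto
  moreover from this have "finite (D i)"
    by (rule finite_subset) simp
  moreover have "Suc T0 * r \<ge> 1"
    using r(3) by simp
  ultimately have "real (card (graph_ball (E G) (D i) (Suc T0 * r))) \<le> C * real (Suc T0 * r) ^ k"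
    using C \<open>G \<in> \<F>\<close> i(2) by blast
  moreover have "card {..<N} \<le> card (graph_ball (E G) (D i) (Suc T0 * r))"
  proof (rule card_le_card_graph_ball_if_simulates[OF H G EG emb via])
    show "unit_conf N {i} \<in> confs H" "unit_conf N {} \<in> confs H"
      by (simp_all add: H_def unit_conf_in_confs)
    \<comment> \<open>At time \<open>r\<close> the single one at \<open>i\<close> has spread to
      every node, while the zero configuration has stayed zero.\<close>
    show "{..<N} \<subseteq> {j. j < nodes H \<and>
        (update H ^^ r) (unit_conf N {i}) j \<noteq> (update H ^^ r) (unit_conf N {}) j}"
      using de_bruijn_relpow_complete[of i r] i(1)
      by (auto simp: H_def funpow_update_unit_conf[OF de_bruijn_subset])
         (auto simp: unit_conf_def N_def)
  qed (use i in \<open>auto simp: unit_conf_def\<close>)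
  then have "2 ^ r \<le> real (card (graph_ball (E G) (D i) (Suc T0 * r)))"
    by (metis N_def card_lessThan of_nat_le_iff of_nat_numeral of_nat_power)
  ultimately show False
    using r(2) by linarith
qed

end
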